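(* Let $\mathcal{V}$ be an $n$-dimensional subspace of the disc algebra $\mathcal{A}(\mathbb{D})$ with basis $(V_1,\ldots,V_n)$. Let $\zeta_1,\ldots,\zeta_m\in\mathbb{T}$ be distinct points, with $n\le m$, let $\zeta_0\in\mathbb{T}\setminus\{\zeta_1,\ldots,\zeta_m\}$, let $Q(F)=F(\zeta_0)$ for $F\in\mathcal{A}(\mathbb{D})$, and let $\mathcal{L}_\zeta:\mathcal{A}(\mathbb{D})\to\mathbb{C}^m$, $\mathcal{L}_\zeta(F)=(F(\zeta_1),\ldots,F(\zeta_m))$. Consider the $\ell_1$-minimization problem $$\underset{a\in\mathbb{C}^m}{\text{minimize}}\ \sum_{k=1}^m|a_k|\qquad\text{subject to}\quad \sum_{k=1}^m a_kV_j(\zeta_k)=V_j(\zeta_0)\ \text{ for all } j=1,\ldots,n.$$ If $a^\star\in\mathbb{C}^m$ is a solution (minimizer) of this problem, then $$\mu_{\mathcal{A}}(\ker(\mathcal{L}_\zeta),\mathcal{V},Q)=1+\sum_{k=1}^m|a_k^\star|,$$ and the linear functional $A^{\rm opt}:\mathbb{C}^m\to\mathbb{C}$ defined by $A^{\rm opt}(y)=\sum_{k=1}^m a_k^\star y_k$ is an optimal algorithm over $\mathcal{K}_{\mathcal{A}}(\varepsilon,\mathcal{V})$ in the sense that, for every $\varepsilon>0$, $$\sup_{F\in\mathcal{K}_{\mathcal{A}}(\varepsilon,\mathcal{V})}|Q(F)-A^{\rm opt}(\mathcal{L}_\zeta(F))|=\inf_{A:\mathbb{C}^m\to\mathbb{C}}\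 \sup_{F\in\mathcal{K}_{\mathcal{A}}(\varepsilon,\mathcal{V})}|Q(F)-A(\mathcal{L}_\zeta(F))|,$$ the infimum being over all maps $A$ (not necessarily linear), and the common value is $\mu_{\mathcal{A}}(\ker(\mathcal{L}_\zeta),\mathcal{V},Q)\,\varepsilon$.
   Context: $\mathbb{D}$ is the open unit disk and $\mathbb{T}=\{z\in\mathbb{C}:|z|=1\}$. The disc algebra $\mathcal{A}(\mathbb{D})$ is the space of functions continuous on $\overline{\mathbb{D}}$ and analytic on $\mathbb{D}$, endowed with the norm $\|F\|_{\mathcal{H}_\infty}=\sup_{|z|=1}|F(z)|$. For a subspace $\mathcal{V}$ of $\mathcal{A}(\mathbb{D})$, $\mathrm{dist}(F,\mathcal{V})=\inf_{V\in\mathcal{V}}\|F-V\|_{\mathcal{H}_\infty}$, and for $\varepsilon>0$ $$\mathcal{K}_{\mathcal{A}}(\varepsilon,\mathcal{V})=\{F\in\mathcal{A}(\mathbb{D}):\mathrm{dist}(F,\mathcal{V})\le\varepsilon\},\qquad \mu_{\mathcal{A}}(\ker(\mathcal{L}_\zeta),\mathcal{V},Q)=\sup_{F\in\ker(\mathcal{L}_\zeta)}\frac{|Q(F)|}{\mathrm{dist}(F,\mathcal{V})},$$ where ratios $0/0$ are disregarded and a ratio with positive numerator and zero denominator is $+\infty$. *)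

theory Defs
  imports "HOL-Complex_Analysis.Complex_Analysis" "HOL-Library.Function_Algebras"
begin

text \<open>
  Functions on the closed unit disc are represented by their extension by zero to the whole plane,
  so that equality, linear independence and dimension of elements of the disc algebra are those of
  functions on the closed disc. The vector space operations are pointwise; the interpretation
  below provides the library's notions of subspace, span, independence and dimension
  over the complex scalars.
\<close>

definition fun_scale :: "complex \<Rightarrow> (complex \<Rightarrow> complex) \<Rightarrow> complex \<Rightarrow> complex" where
  "fun_scale c F = (\<lambda>z. c * F z)"

global_interpretation fun_vs: vector_space fun_scale
  by unfold_locales (auto simp: fun_scale_def fun_eq_iff algebra_simps)

definition disc_algebra :: "(complex \<Rightarrow> complex) set" where
  "disc_algebra =
     {F. continuous_on (cball 0 1) F \<and> F holomorphic_on ball 0 1 \<and> (\<forall>z. z \<notin> cball 0 1 \<longrightarrow> F z = 0)}"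

lemma subspace_disc_algebra: "fun_vs.subspace disc_algebra"
  by (auto simp: fun_vs.subspace_def disc_algebra_def fun_scale_def plus_fun_def zero_fun_def
           intro!: continuous_intros holomorphic_intros)

definition hinf_norm :: "(complex \<Rightarrow> complex) \<Rightarrow> real" where
  "hinf_norm F = (SUP z\<in>sphere 0 1. cmod (F z))"

definition dist_to :: "(complex \<Rightarrow> complex) \<Rightarrow> (complex \<Rightarrow> complex) set \<Rightarrow> real" where
  "dist_to F \<V> = (INF V\<in>\<V>. hinf_norm (F - V))"

definition model_set :: "real \<Rightarrow> (complex \<Rightarrow> complex) set \<Rightarrow> (complex \<Rightarrow> complex) set" where
  "model_set \<epsilon> \<V> = {F \<in> disc_algebra. dist_to F \<V> \<le> \<epsilon>}"

definition sample :: "('m::finite \<Rightarrow> complex) \<Rightarrow> (complex \<Rightarrow> complex) \<Rightarrow> complex ^ 'm" where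
  "sample \<zeta> F = (\<chi> k. F (\<zeta> k))"

definition sample_kernel :: "('m::finite \<Rightarrow> complex) \<Rightarrow> (complex \<Rightarrow> complex) set" where
  "sample_kernel \<zeta> = {F \<in> disc_algebra. sample \<zeta> F = 0}"

text \<open>
  In \<^typ>\<open>ennreal\<close>, a nonzero number divided by zero is \<open>\<infinity>\<close>. Ratios \<open>0/0\<close> are left out.
\<close>

definition compat_indicator ::
  "(complex \<Rightarrow> complex) set \<Rightarrow> (complex \<Rightarrow> complex) set \<Rightarrow> ((complex \<Rightarrow> complex) \<Rightarrow> complex) \<Rightarrow> ennreal" where
  "compat_indicator N \<V> Q =
     (SUP F\<in>{F \<in> N. \<not> (Q F = 0 \<and> dist_to F \<V> = 0)}. ennreal (cmod (Q F)) / ennreal (dist_to F \<V>))"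

definition worst_case_error ::
  "(complex \<Rightarrow> complex) set \<Rightarrow> ((complex \<Rightarrow> complex) \<Rightarrow> complex) \<Rightarrow> ('m::finite \<Rightarrow> complex)
     \<Rightarrow> (complex ^ 'm \<Rightarrow> complex) \<Rightarrow> ennreal" where
  "worst_case_error K Q \<zeta> A = (SUP F\<in>K. ennreal (cmod (Q F - A (sample \<zeta> F))))"

end

theory Submission
  imports Defs
begin

text \<open>
  Write \<open>s\<close> for the minimal value \<open>\<Sum>k. |a\<^sub>k|\<close>. Every feasible vector is exact on \<open>\<V>\<close>, by linearity.
  Hence the error \<open>F \<zeta>\<^sub>0 - (\<Sum>k. a\<^sub>k F(\<zeta>\<^sub>k))\<close> does not change when \<open>F\<close> is replaced by \<open>F - V\<close> with
  \<open>V \<in> \<V>\<close>, and it is at most \<open>(1 + s)\<close> times the distance from \<open>F\<close> to \<open>\<V>\<close>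
  (\<open>quadrature_error_bound\<close>). On the kernel of the sampling map the error is just \<open>F \<zeta>\<^sub>0\<close>. This gives
  the upper bounds on the compatibility indicator and on the worst-case error.

  The lower bounds need a function in the kernel for which the estimate is nearly sharp. Two facts
  produce it. First, by duality for the minimization problem (\<open>l1_minimizer_norming_element\<close>), some
  \<open>V \<in> \<V>\<close> has values of modulus at most 1 at all \<open>\<zeta>\<^sub>k\<close> and the value \<open>s\<close> at \<open>\<zeta>\<^sub>0\<close>. Second, finitely
  many values of modulus at most 1 on the circle are interpolated by an element of the disc algebra
  whose norm is as close to 1 as desired (\<open>small_norm_interpolation\<close>), which is an approximate form
  of the Rudin--Carleson theorem for finite sets. Let \<open>G\<close> interpolate \<open>V\<close> at all \<open>\<zeta>\<^sub>k\<close> and the value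
  \<open>-1\<close> at \<open>\<zeta>\<^sub>0\<close>. Then \<open>V - G\<close> vanishes at every \<open>\<zeta>\<^sub>k\<close>, takes the value \<open>1 + s\<close> at \<open>\<zeta>\<^sub>0\<close>, and its distance
  to \<open>\<V>\<close> is at most the norm of \<open>G\<close> (\<open>nearly_extremal_function\<close>).

  No map \<open>A\<close> can distinguish such a function \<open>F\<close> from \<open>-F\<close>, since both have zero samples; so every
  algorithm errs by at least \<open>|F \<zeta>\<^sub>0|\<close> on one of the two
  (\<open>worst_case_error_ge_kernel_value\<close>).
\<close>

(* The dollar sign is reserved for the components of vectors. *)
no_notation fps_nth (infixl "$" 75)

section \<open>Elements of the disc algebra and distances\<close>

lemma disc_algebra_bdd:
  assumes "F \<in> disc_algebra"
  shows "bdd_above ((\<lambda>z. cmod (F z)) ` sphere 0 1)"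
proof -
  have "continuous_on (sphere 0 1) F"
    using assms by (auto simp: disc_algebra_def intro: continuous_on_subset)
  then have "compact ((\<lambda>z. cmod (F z)) ` sphere 0 1)"
    by (intro compact_continuous_image continuous_intros) auto
  then show ?thesis by (simp add: bounded_imp_bdd_above compact_imp_bounded)
qed

lemma norm_le_hinf_norm:
  assumes "F \<in> disc_algebra" "z \<in> sphere 0 1"
  shows "cmod (F z) \<le> hinf_norm F"
  unfolding hinf_norm_def by (rule cSUP_upper[OF assms(2) disc_algebra_bdd[OF assms(1)]])

lemma hinf_norm_le:
  assumes "\<And>z. z \<in> sphere 0 1 \<Longrightarrow> cmod (F z) \<le> c"
  shows "hinf_norm F \<le> c"
  unfolding hinf_norm_def by (rule cSUP_least) (use assms in auto)

lemma hinf_norm_nonneg: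
  assumes "F \<in> disc_algebra"
  shows "0 \<le> hinf_norm F"
  using order_trans[OF norm_ge_zero norm_le_hinf_norm[OF assms, of 1]] by simp

lemma dist_to_le:
  assumes "F \<in> disc_algebra" "\<V> \<subseteq> disc_algebra" "V \<in> \<V>"
  shows "dist_to F \<V> \<le> hinf_norm (F - V)"
proof -
  have "F - W \<in> disc_algebra" if "W \<in> \<V>" for W
    using assms that by (intro fun_vs.subspace_diff[OF subspace_disc_algebra]) auto
  then have "bdd_below ((\<lambda>V. hinf_norm (F - V)) ` \<V>)"
    by (intro bdd_belowI[of _ 0]) (auto intro: hinf_norm_nonneg)
  then show ?thesis unfolding dist_to_def by (rule cINF_lower) fact
qed

lemma le_dist_to:
  assumes "\<V> \<noteq> {}" "\<And>V. V \<in> \<V> \<Longrightarrow> c \<le> hinf_norm (F - V)"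
  shows "c \<le> dist_to F \<V>"
  unfolding dist_to_def by (rule cINF_greatest) (use assms in auto)

lemma cutoff_in_disc_algebra:
  assumes "g holomorphic_on UNIV"
  shows "(\<lambda>z. if z \<in> cball 0 1 then g z else 0) \<in> disc_algebra"
proof -
  have "continuous_on (cball 0 1) g" "g holomorphic_on ball 0 1"
    using assms holomorphic_on_imp_continuous_on continuous_on_subset holomorphic_on_subset
    by (metis subset_UNIV)+
  then show ?thesis
    unfolding disc_algebra_def
    by (auto cong: continuous_on_cong_simp
        intro: holomorphic_transform[of g])
qed

section \<open>Interpolation on finitely many points of the circle\<close>

text \<open>
  For \<open>s\<close> on the circle, \<open>(1 + cnj s * z) / 2\<close> peaks at \<open>s\<close>: it is 1 there, and on the rest of the
  circle its modulus is below 1. Its powers therefore concentrate at \<open>s\<close>.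
\<close>

lemma peak_norm_le: "cmod ((1 + cnj s * z) / 2) \<le> 1" if "cmod s = 1" "cmod z = 1"
  using norm_triangle_ineq[of 1 "cnj s * z"] that by (simp add: norm_mult norm_divide)

lemma peak_norm_less:
  assumes "cmod s = 1" "cmod z = 1" "z \<noteq> s"
  shows "cmod ((1 + cnj s * z) / 2) < 1"
proof -
  define u where "u = cnj s * z"
  have "s * cnj s = 1"
    using assms(1) by (metis complex_norm_square of_real_1 one_power2)
  then have "u \<noteq> 1"
    using assms(3) unfolding u_def by (metis mult.commute mult.left_commute mult_1)
  have "cmod u = 1"
    using assms by (simp add: u_def norm_mult)
  then have sq: "(Re u)\<^sup>2 + (Im u)\<^sup>2 = 1"
    by (metis cmod_power2 one_power2)
  have "Re u < 1"
  proof (rule ccontr)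
    assume "\<not> Re u < 1"
    moreover have "Re u \<le> 1" using complex_Re_le_cmod[of u] \<open>cmod u = 1\<close> by simp
    ultimately have "Re u = 1" by simp
    with sq have "Im u = 0" by simp
    with \<open>Re u = 1\<close> \<open>u \<noteq> 1\<close> show False by (simp add: complex_eq_iff)
  qed
  moreover have "(cmod (1 + u))\<^sup>2 = 2 + 2 * Re u"
    unfolding cmod_power2 using sq by (simp add: power2_eq_square algebra_simps)
  ultimately have "(cmod (1 + u))\<^sup>2 < 2\<^sup>2" by simp
  then have "cmod (1 + u) < 2" by (rule power_less_imp_less_base) simp
  then show ?thesis unfolding u_def by (simp add: norm_divide)
qed

text \<open>
  The Lagrange polynomials of \<open>S\<close> interpolate but may be large on the circle; multiplying each by a
  high power of the peak function at its node keeps the interpolation property. The sum \<open>f N\<close> of the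
  moduli of the resulting basis functions decreases in the exponent \<open>N\<close>, with pointwise limit 1 on
  \<open>S\<close> and 0 elsewhere on the circle. By compactness, as in Dini's theorem, \<open>f N\<close> lies below any
  \<open>c > 1\<close> on the whole circle for some \<open>N\<close>.
\<close>

lemma small_norm_interpolation:
  fixes S :: "complex set" and w :: "complex \<Rightarrow> complex"
  assumes S: "finite S" "S \<subseteq> sphere 0 1" and w: "\<And>s. s \<in> S \<Longrightarrow> cmod (w s) \<le> 1"
    and c: "c > 1"
  obtains G where "G \<in> disc_algebra" "\<And>s. s \<in> S \<Longrightarrow> G s = w s" "hinf_norm G \<le> c"
proof -
  define q where "q s z = (\<Prod>r\<in>S - {s}. (z - r) / (s - r))" for s z
  define p where "p s z = (1 + cnj s * z) / 2" for s z :: complex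
  define f where "f N z = (\<Sum>s\<in>S. cmod (q s z) * cmod (p s z) ^ N)" for N z
  have q_eq: "q s r = (if r = s then 1 else 0)" if "s \<in> S" "r \<in> S" for s r
  proof (cases "r = s")
    case False
    then show ?thesis using that S(1) by (auto simp: q_def intro!: prod_zero)
  next
    case True
    then show ?thesis unfolding q_def by (auto intro!: prod.neutral split: if_splits)
  qed
  have norm1: "cmod s = 1" if "s \<in> S" for s using that S(2) by auto
  have p_self: "p s s = 1" if "s \<in> S" for s
    using complex_norm_square[of s] norm1[OF that] by (simp add: p_def mult.commute)
  have cont: "continuous_on (sphere 0 1) (f N)" for N
    unfolding f_def p_def q_def by (intro continuous_intros) auto
  define K where "K N = {z \<in> sphere 0 1. c \<le> f N z}" for N
  have K_compact: "compact (K N)" for N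
  proof -
    have "closed (K N)" unfolding K_def
      by (intro continuous_on_closed_Collect_le cont continuous_intros) auto
    moreover have "bounded (K N)"
      by (rule bounded_subset[of "sphere 0 1"]) (auto simp: K_def)
    ultimately show ?thesis by (simp add: compact_eq_bounded_closed)
  qed
  have K_mono: "K N \<subseteq> K M" if "M \<le> N" for M N
  proof -
    have "f N z \<le> f M z" if "cmod z = 1" for z
      unfolding f_def using \<open>M \<le> N\<close> peak_norm_le[OF norm1 that]
      by (intro sum_mono mult_left_mono power_decreasing) (auto simp: p_def)
    then show ?thesis by (force simp: K_def)
  qed
  have lim: "\<exists>N. f N z < c" if z: "cmod z = 1" for z
  proof -
    have "(\<lambda>N. cmod (q s z) * cmod (p s z) ^ N) \<longlonglongrightarrow> (if z = s then 1 else 0)"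
      if "s \<in> S" for s
    proof (cases "z = s")
      case True
      then show ?thesis using that q_eq p_self by simp
    next
      case False
      then have "cmod (p s z) < 1"
        using peak_norm_less[OF norm1[OF that] z] by (simp add: p_def)
      then have "(\<lambda>N. cmod (p s z) ^ N) \<longlonglongrightarrow> 0" by (intro LIMSEQ_realpow_zero) auto
      then show ?thesis using False by (auto intro: tendsto_mult_right_zero)
    qed
    then have "(\<lambda>N. f N z) \<longlonglongrightarrow> (\<Sum>s\<in>S. if z = s then 1 else 0)"
      unfolding f_def by (intro tendsto_sum)
    moreover have "(\<Sum>s\<in>S. if z = s then 1 else 0) < c"
      using S(1) c by (simp add: sum.delta)
    ultimately have "\<forall>\<^sub>F N in sequentially. f N z < c" by (rule order_tendstoD(2))
    then show ?thesis by (auto dest: eventually_happens)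
  qed
  have "\<exists>N. K N = {}"
  proof (rule ccontr)
    assume "\<nexists>N. K N = {}"
    then have "\<Inter> (range K) \<noteq> {}"
      by (intro compact_nest) (use K_compact K_mono in auto)
    then obtain z where "\<forall>N. z \<in> K N" by auto
    then have "cmod z = 1" "\<forall>N. c \<le> f N z" by (auto simp: K_def)
    then show False using lim[of z] by (metis not_le)
  qed
  then obtain N where "K N = {}" by blast
  then have N: "f N z < c" if "cmod z = 1" for z
    using that by (auto simp: K_def not_le)
  define g where "g z = (\<Sum>s\<in>S. w s * (q s z * p s z ^ N))" for z
  define G where "G z = (if z \<in> cball 0 1 then g z else 0)" for z
  show ?thesis
  proof
    have "g holomorphic_on UNIV"
      unfolding g_def q_def p_def divide_inverse by (intro holomorphic_intros)
    then show "G \<in> disc_algebra" unfolding G_def by (rule cutoff_in_disc_algebra)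
    show "G s = w s" if "s \<in> S" for s
    proof -
      have "g s = (\<Sum>r\<in>S. if r = s then w r else 0)"
        unfolding g_def using that by (intro sum.cong) (auto simp: q_eq p_self)
      then show ?thesis using that S(1) norm1[OF that] by (simp add: G_def)
    qed
    show "hinf_norm G \<le> c"
    proof (rule hinf_norm_le)
      fix z :: complex
      assume z: "z \<in> sphere 0 1"
      have "cmod (g z) \<le> (\<Sum>s\<in>S. cmod (w s) * (cmod (q s z) * cmod (p s z) ^ N))"
        unfolding g_def by (rule norm_sum[THEN order_trans]) (simp add: norm_mult norm_power)
      also have "\<dots> \<le> f N z"
        unfolding f_def using w by (intro sum_mono mult_left_le_one_le) auto
      also have "\<dots> \<le> c" using N[of z] z by simp
      finally show "cmod (G z) \<le> c" using c by (simp add: G_def)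
    qed
  qed
qed

section \<open>Duality for the minimization problem\<close>

text \<open>
  The hypothesis \<open>min\<close> says that \<open>a\<close> has the least \<open>\<ell>\<^sub>1\<close> norm in the affine space \<open>a + N\<close>, where \<open>N\<close> is the
  annihilator of \<open>W\<close>. So \<open>a + N\<close> misses the open \<open>\<ell>\<^sub>1\<close> ball of radius equal to the norm of \<open>a\<close>, and a
  hyperplane separates the two. Its normal is orthogonal to \<open>N\<close> and hence, up to conjugation, lies
  in \<open>W\<close>; scaled to maximum norm 1, it is the required \<open>w\<close>. For \<open>a = 0\<close> the ball is empty, and \<open>w = 0\<close> will do.
\<close>

lemma l1_minimizer_norming_element:
  fixes W :: "(complex ^ 'm::finite) set" and a :: "complex ^ 'm"
  assumes W0: "0 \<in> W" and Wadd: "\<And>x y. x \<in> W \<Longrightarrow> y \<in> W \<Longrightarrow> x + y \<in> W"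
    and Wscale: "\<And>c x. x \<in> W \<Longrightarrow> c *s x \<in> W"
    and min: "\<And>b. (\<And>w. w \<in> W \<Longrightarrow> (\<Sum>k\<in>UNIV. b $ k * w $ k) = (\<Sum>k\<in>UNIV. a $ k * w $ k))
      \<Longrightarrow> (\<Sum>k\<in>UNIV. cmod (a $ k)) \<le> (\<Sum>k\<in>UNIV. cmod (b $ k))"
  obtains w where "w \<in> W" "\<And>k. cmod (w $ k) \<le> 1"
    "(\<Sum>k\<in>UNIV. a $ k * w $ k) = of_real (\<Sum>k\<in>UNIV. cmod (a $ k))"
proof (cases "a = 0")
  case True
  then show ?thesis using that[of 0] W0 by simp
next
  case False
  define l1 :: "complex ^ 'm \<Rightarrow> real" where "l1 b = (\<Sum>k\<in>UNIV. cmod (b $ k))" for b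
  define conj :: "complex ^ 'm \<Rightarrow> complex ^ 'm" where "conj x = (\<chi> k. cnj (x $ k))" for x
  (* The bilinear pairing of b and w is, up to its imaginary part, the real inner product of b with
     the conjugate of w. *)
  define N where "N = orthogonal_comp (conj ` W)"
  have inner_conj: "b \<bullet> conj w = Re (\<Sum>k\<in>UNIV. b $ k * w $ k)" for b w
    by (simp add: inner_vec_def conj_def inner_complex_def)
  have sub: "subspace (conj ` W)"
  proof (rule subspaceI)
    show "0 \<in> conj ` W"
      by (rule image_eqI[OF _ W0]) (simp add: conj_def vec_eq_iff)
  next
    fix x y assume "x \<in> conj ` W" "y \<in> conj ` W"
    then obtain x' y' where "x = conj x'" "y = conj y'" "x' \<in> W" "y' \<in> W" by auto
    then show "x + y \<in> conj ` W"
      by (intro image_eqI[OF _ Wadd[of x' y']]) (simp_all add: conj_def vec_eq_iff)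
  next
    fix c :: real and x assume "x \<in> conj ` W"
    then obtain x' where "x = conj x'" "x' \<in> W" by auto
    then show "c *\<^sub>R x \<in> conj ` W"
      by (intro image_eqI[OF _ Wscale[of x' "of_real c"]])
        (simp_all add: conj_def vec_eq_iff scaleR_conv_of_real[where 'a=complex])
  qed
  have N_annihilates: "(\<Sum>k\<in>UNIV. b $ k * w $ k) = 0" if "b \<in> N" "w \<in> W" for b w
  proof -
    have re: "Re (\<Sum>k\<in>UNIV. b $ k * v $ k) = 0" if "v \<in> W" for v
      using \<open>b \<in> N\<close> that inner_conj[of b v]
      by (auto simp: N_def orthogonal_comp_def orthogonal_def inner_commute)
    (* Real orthogonality only controls the real part; the vector i w controls the imaginary part. *)
    have "(\<Sum>k\<in>UNIV. b $ k * (\<i> *s w) $ k) = \<i> * (\<Sum>k\<in>UNIV. b $ k * w $ k)"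
      by (simp add: sum_distrib_left mult.left_commute)
    then have "Im (\<Sum>k\<in>UNIV. b $ k * w $ k) = 0"
      using re[OF Wscale[OF \<open>w \<in> W\<close>, of \<i>]] by simp
    then show ?thesis using re[OF \<open>w \<in> W\<close>] by (simp add: complex_eq_iff)
  qed
  have l1_min: "l1 a \<le> l1 (a + b)" if "b \<in> N" for b
    unfolding l1_def
    by (rule min) (simp add: distrib_right sum.distrib N_annihilates[OF that])
  have l1_pos: "l1 a > 0"
  proof -
    obtain k where "a $ k \<noteq> 0" using False by (auto simp: vec_eq_iff)
    then show ?thesis unfolding l1_def by (intro sum_pos2[of _ k]) auto
  qed
  have l1_triangle: "l1 (x + y) \<le> l1 x + l1 y" for x y
    unfolding l1_def by (simp add: norm_triangle_ineq sum_mono flip: sum.distrib)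
  have l1_scale: "l1 (t *\<^sub>R x) = \<bar>t\<bar> * l1 x" for t x
    unfolding l1_def by (simp add: sum_distrib_left)
  have "convex {x. l1 x < l1 a}"
  proof (rule convexI)
    fix x y and u v :: real
    assume *: "x \<in> {x. l1 x < l1 a}" "y \<in> {x. l1 x < l1 a}" "0 \<le> u" "0 \<le> v" "u + v = 1"
    have "l1 (u *\<^sub>R x + v *\<^sub>R y) \<le> u * l1 x + v * l1 y"
      using l1_triangle[of "u *\<^sub>R x" "v *\<^sub>R y"] * by (simp add: l1_scale)
    also have "\<dots> < l1 a"
      using * convex_bound_lt[of "l1 x" "l1 a" "l1 y" u v] by simp
    finally show "u *\<^sub>R x + v *\<^sub>R y \<in> {x. l1 x < l1 a}" by simp
  qed
  moreover have "convex ((+) a ` N)"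
    unfolding N_def by (intro convex_translation subspace_imp_convex subspace_orthogonal_comp)
  moreover have "{x. l1 x < l1 a} \<noteq> {}"
    using l1_pos by (auto intro!: exI[of _ 0] simp: l1_def)
  moreover have "(+) a ` N \<noteq> {}"
    using subspace_0[OF subspace_orthogonal_comp[of "conj ` W"]] by (auto simp: N_def)
  moreover have "{x. l1 x < l1 a} \<inter> (+) a ` N = {}"
    using l1_min by force
  ultimately obtain c \<beta> where "c \<noteq> 0"
    and sep: "\<forall>x\<in>{x. l1 x < l1 a}. c \<bullet> x \<le> \<beta>" "\<forall>x\<in>(+) a ` N. \<beta> \<le> c \<bullet> x"
    using separating_hyperplane_sets[of "{x. l1 x < l1 a}" "(+) a ` N"] by blast
  from sep have c_ball: "\<And>x. l1 x < l1 a \<Longrightarrow> c \<bullet> x \<le> \<beta>"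
    and c_aff: "\<And>b. b \<in> N \<Longrightarrow> \<beta> \<le> c \<bullet> (a + b)"
    by auto
  have l1_axis: "l1 (axis k z) = cmod z" for k z
  proof -
    have "l1 (axis k z) = (\<Sum>i\<in>UNIV. if i = k then cmod z else 0)"
      unfolding l1_def by (intro sum.cong) (auto simp: axis_def)
    then show ?thesis by simp
  qed
  have c_le: "l1 a * cmod (c $ k) \<le> \<beta>" for k
  proof (rule field_le_mult_one_interval)
    fix t :: real assume t: "0 < t" "t < 1"
    (* In the ball, the coordinate direction k with the phase of the normal is the one that detects
       the modulus of its k-th component. *)
    define x where "x = axis k (of_real (t * l1 a) * sgn (c $ k))"
    have "l1 x = t * l1 a * cmod (sgn (c $ k))"
      unfolding x_def l1_axis using l1_pos t by (simp add: norm_mult)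
    also have "\<dots> \<le> t * l1 a * 1"
      using t l1_pos by (intro mult_left_mono) (auto simp: norm_sgn)
    also have "\<dots> < l1 a" using t l1_pos by simp
    finally have "c \<bullet> x \<le> \<beta>" by (rule c_ball)
    moreover have "c $ k \<bullet> sgn (c $ k) = cmod (c $ k)"
      by (cases "c $ k = 0") (simp_all add: sgn_div_norm dot_square_norm power2_eq_square)
    then have "c \<bullet> x = t * (l1 a * cmod (c $ k))"
      unfolding x_def inner_axis scaleR_conv_of_real[symmetric] by simp
    ultimately show "t * (l1 a * cmod (c $ k)) \<le> \<beta>" by simp
  qed
  have c_N: "c \<bullet> b = 0" if "b \<in> N" for b
  proof (rule ccontr)
    assume ne: "c \<bullet> b \<noteq> 0"
    (* A functional that is not zero on the subspace N takes values below \<beta> on a + N: this multiple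
       of b gives the value \<beta> - 1. *)
    define t where "t = (\<beta> - 1 - c \<bullet> a) / (c \<bullet> b)"
    have "t *\<^sub>R b \<in> N"
      using that unfolding N_def by (intro subspace_scale subspace_orthogonal_comp)
    from c_aff[OF this] ne show False by (simp add: inner_add_right t_def)
  qed
  have "c \<in> orthogonal_comp N"
    using c_N by (auto simp: orthogonal_comp_def orthogonal_def inner_commute)
  then have "c \<in> conj ` W"
    using orthogonal_comp_self[OF sub] by (simp add: N_def)
  then obtain v where v: "v \<in> W" "c = conj v" by auto
  define M where "M = Max (range (\<lambda>k. cmod (v $ k)))"
  have v_le: "cmod (v $ k) \<le> M" for k unfolding M_def by (intro Max_ge) auto
  have "M \<in> range (\<lambda>k. cmod (v $ k))" unfolding M_def by (intro Max_in) auto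
  then obtain k0 where k0: "cmod (v $ k0) = M" by auto
  have "M > 0"
  proof -
    obtain k where "v $ k \<noteq> 0" using \<open>c \<noteq> 0\<close> v by (auto simp: vec_eq_iff conj_def)
    then show ?thesis using v_le[of k] by (metis zero_less_norm_iff order_less_le_trans)
  qed
  define w where "w = (1 / of_real M :: complex) *s v"
  have w_le: "cmod (w $ k) \<le> 1" for k
    using v_le[of k] \<open>M > 0\<close> by (simp add: w_def norm_mult norm_divide)
  have "l1 a * M \<le> c \<bullet> a"
  proof -
    have "l1 a * M \<le> \<beta>" using c_le[of k0] k0 v by (simp add: conj_def)
    also have "\<beta> \<le> c \<bullet> a"
      using c_aff[of 0] subspace_0[OF subspace_orthogonal_comp[of "conj ` W"]]
      by (simp add: N_def)
    finally show ?thesis .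
  qed
  moreover have "c \<bullet> a = Re (\<Sum>k\<in>UNIV. a $ k * v $ k)"
    unfolding v(2) by (subst inner_commute) (rule inner_conj)
  moreover have "(\<Sum>k\<in>UNIV. a $ k * w $ k) = (\<Sum>k\<in>UNIV. a $ k * v $ k) / of_real M"
    by (simp add: w_def sum_divide_distrib)
  then have "Re (\<Sum>k\<in>UNIV. a $ k * w $ k) = Re (\<Sum>k\<in>UNIV. a $ k * v $ k) / M"
    by (simp only: Re_divide_of_real)
  ultimately have ge: "l1 a \<le> Re (\<Sum>k\<in>UNIV. a $ k * w $ k)"
    using \<open>M > 0\<close> by (simp only: pos_le_divide_eq)
  have le: "cmod (\<Sum>k\<in>UNIV. a $ k * w $ k) \<le> l1 a"
    unfolding l1_def
    by (rule sum_norm_le) (use w_le in \<open>simp add: norm_mult mult_left_le\<close>)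
  have "(\<Sum>k\<in>UNIV. a $ k * w $ k) = of_real (l1 a)"
  proof -
    have *: "z = of_real r" if "r \<le> Re z" "cmod z \<le> r" for z r
    proof -
      have "Re z = r" "cmod z = Re z" "0 \<le> r"
        using that complex_Re_le_cmod[of z] norm_ge_zero[of z] by linarith+
      then show ?thesis using complex_is_Real_iff[of z]
        by (metis cmod_eq_Re complex_eq_iff cmod_power2 add_cancel_left_right
            power_eq_0_iff zero_neq_numeral Re_complex_of_real Im_complex_of_real)
    qed
    show ?thesis by (rule *[OF ge le])
  qed
  moreover have "w \<in> W" unfolding w_def by (rule Wscale) fact
  ultimately show ?thesis using that[of w] w_le by (simp add: l1_def)
qed

section \<open>Optimality of the minimizer\<close>

lemma quadrature_error_bound:
  fixes \<zeta> :: "'m::finite \<Rightarrow> complex" and a :: "complex ^ 'm"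
  assumes F: "F \<in> disc_algebra" and \<V>: "\<V> \<subseteq> disc_algebra" "\<V> \<noteq> {}"
    and \<zeta>: "range \<zeta> \<subseteq> sphere 0 1" "\<zeta>\<^sub>0 \<in> sphere 0 1"
    and exact: "\<And>V. V \<in> \<V> \<Longrightarrow> (\<Sum>k\<in>UNIV. a $ k * V (\<zeta> k)) = V \<zeta>\<^sub>0"
  shows "cmod (F \<zeta>\<^sub>0 - (\<Sum>k\<in>UNIV. a $ k * F (\<zeta> k)))
    \<le> (1 + (\<Sum>k\<in>UNIV. cmod (a $ k))) * dist_to F \<V>" (is "?e \<le> ?s * _")
proof -
  have s: "?s > 0" by (intro add_pos_nonneg sum_nonneg) auto
  have "?e / ?s \<le> hinf_norm (F - V)" if V: "V \<in> \<V>" for V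
  proof -
    define D where "D = F - V"
    have D: "D \<in> disc_algebra"
      unfolding D_def using F V \<V> by (intro fun_vs.subspace_diff[OF subspace_disc_algebra]) auto
    have "F \<zeta>\<^sub>0 - (\<Sum>k\<in>UNIV. a $ k * F (\<zeta> k)) = D \<zeta>\<^sub>0 - (\<Sum>k\<in>UNIV. a $ k * D (\<zeta> k))"
      using exact[OF V] by (simp add: D_def algebra_simps sum_subtractf)
    also have "cmod \<dots> \<le> cmod (D \<zeta>\<^sub>0) + cmod (\<Sum>k\<in>UNIV. a $ k * D (\<zeta> k))"
      by (rule norm_triangle_ineq4)
    also have "\<dots> \<le> hinf_norm D + (\<Sum>k\<in>UNIV. cmod (a $ k) * hinf_norm D)"
      using \<zeta> by (intro add_mono norm_le_hinf_norm[OF D] sum_norm_le)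
        (auto simp: norm_mult intro!: mult_left_mono norm_le_hinf_norm[OF D])
    also have "\<dots> = ?s * hinf_norm D" by (simp add: distrib_right sum_distrib_right)
    finally show ?thesis using s by (simp add: D_def field_simps)
  qed
  then have "?e / ?s \<le> dist_to F \<V>" by (rule le_dist_to[OF \<V>(2)])
  then show ?thesis using s by (simp add: field_simps)
qed

text \<open>
  Up to the scaling by \<open>t * \<epsilon>\<close>, this is the function \<open>V - G\<close> with \<open>V\<close> the norming element of \<open>\<V>\<close> and
  \<open>G\<close> an interpolant of norm at most \<open>1 / t\<close>. The factor \<open>t < 1\<close> absorbs the excess of that norm
  over 1.
\<close>

lemma nearly_extremal_function:
  fixes \<zeta> :: "'m::finite \<Rightarrow> complex" and a :: "complex ^ 'm"
  assumes \<V>: "fun_vs.subspace \<V>" "\<V> \<subseteq> disc_algebra"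
    and \<zeta>: "inj \<zeta>" "range \<zeta> \<subseteq> sphere 0 1" "\<zeta>\<^sub>0 \<in> sphere 0 1 - range \<zeta>"
    and exact: "\<And>V. V \<in> \<V> \<Longrightarrow> (\<Sum>k\<in>UNIV. a $ k * V (\<zeta> k)) = V \<zeta>\<^sub>0"
    and min: "\<And>b. (\<And>V. V \<in> \<V> \<Longrightarrow> (\<Sum>k\<in>UNIV. b $ k * V (\<zeta> k)) = V \<zeta>\<^sub>0)
      \<Longrightarrow> (\<Sum>k\<in>UNIV. cmod (a $ k)) \<le> (\<Sum>k\<in>UNIV. cmod (b $ k))"
    and t: "0 < t" "t < 1" and \<epsilon>: "\<epsilon> > 0"
  obtains F where "F \<in> sample_kernel \<zeta>" "dist_to F \<V> \<le> \<epsilon>"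
    "F \<zeta>\<^sub>0 = of_real (t * ((1 + (\<Sum>k\<in>UNIV. cmod (a $ k))) * \<epsilon>))"
proof -
  define s where "s = (\<Sum>k\<in>UNIV. cmod (a $ k))"
  obtain w where "w \<in> sample \<zeta> ` \<V>" and w_le: "\<And>k. cmod (w $ k) \<le> 1"
    and w_a: "(\<Sum>k\<in>UNIV. a $ k * w $ k) = of_real s"
  proof (rule l1_minimizer_norming_element[of "sample \<zeta> ` \<V>" a])
    show "0 \<in> sample \<zeta> ` \<V>"
      by (rule image_eqI[OF _ fun_vs.subspace_0[OF \<V>(1)]]) (simp add: sample_def vec_eq_iff)
  next
    fix x y assume "x \<in> sample \<zeta> ` \<V>" "y \<in> sample \<zeta> ` \<V>"
    then obtain x' y' where "x = sample \<zeta> x'" "y = sample \<zeta> y'" "x' \<in> \<V>" "y' \<in> \<V>" by auto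
    then show "x + y \<in> sample \<zeta> ` \<V>"
      by (intro image_eqI[OF _ fun_vs.subspace_add[OF \<V>(1), of x' y']])
        (simp_all add: sample_def vec_eq_iff)
  next
    fix c x assume "x \<in> sample \<zeta> ` \<V>"
    then obtain x' where "x = sample \<zeta> x'" "x' \<in> \<V>" by auto
    then show "c *s x \<in> sample \<zeta> ` \<V>"
      by (intro image_eqI[OF _ fun_vs.subspace_scale[OF \<V>(1), of x' c]])
        (simp_all add: sample_def vec_eq_iff fun_scale_def)
  next
    fix b
    assume b: "\<And>w. w \<in> sample \<zeta> ` \<V> \<Longrightarrow> (\<Sum>k\<in>UNIV. b $ k * w $ k) = (\<Sum>k\<in>UNIV. a $ k * w $ k)"
    show "(\<Sum>k\<in>UNIV. cmod (a $ k)) \<le> (\<Sum>k\<in>UNIV. cmod (b $ k))"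
    proof (rule min)
      fix V assume "V \<in> \<V>"
      then show "(\<Sum>k\<in>UNIV. b $ k * V (\<zeta> k)) = V \<zeta>\<^sub>0"
        using b[of "sample \<zeta> V"] exact[of V] by (simp add: sample_def)
    qed
  qed (use s_def that in blast)
  then obtain V where V: "V \<in> \<V>" "w = sample \<zeta> V" by auto
  have V\<zeta>: "V (\<zeta> k) = w $ k" for k using V by (simp add: sample_def)
  have V\<zeta>0: "V \<zeta>\<^sub>0 = of_real s" using exact[OF V(1)] w_a by (simp add: V\<zeta>)
  obtain G where G: "G \<in> disc_algebra" "hinf_norm G \<le> 1 / t"
    and G_eq: "\<And>z. z \<in> insert \<zeta>\<^sub>0 (range \<zeta>) \<Longrightarrow> G z = (if z = \<zeta>\<^sub>0 then - 1 else V z)"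
  proof (rule small_norm_interpolation[of "insert \<zeta>\<^sub>0 (range \<zeta>)"
        "\<lambda>z. if z = \<zeta>\<^sub>0 then - 1 else V z" "1 / t"])
    show "1 < 1 / t" using t by simp
  qed (use \<zeta> w_le V\<zeta> in auto)
  define r :: complex where "r = of_real (t * \<epsilon>)"
  define F where "F = fun_scale r (V - G)"
  have disc: "F \<in> disc_algebra"
    unfolding F_def using V \<V> G
    by (intro fun_vs.subspace_scale fun_vs.subspace_diff subspace_disc_algebra) auto
  show ?thesis
  proof
    have "F (\<zeta> k) = 0" for k
      using G_eq[of "\<zeta> k"] \<zeta>(3) by (auto simp: F_def fun_scale_def)
    then show "F \<in> sample_kernel \<zeta>"
      using disc by (simp add: sample_kernel_def sample_def vec_eq_iff)
    have "dist_to F \<V> \<le> hinf_norm (F - fun_scale r V)"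
      by (intro dist_to_le disc \<V> fun_vs.subspace_scale V)
    also have "\<dots> \<le> \<epsilon>"
    proof (rule hinf_norm_le)
      fix z :: complex assume "z \<in> sphere 0 1"
      then have "cmod (G z) \<le> 1 / t" using norm_le_hinf_norm[OF G(1)] G(2) by force
      then have "t * \<epsilon> * cmod (G z) \<le> t * \<epsilon> * (1 / t)"
        using t \<epsilon> by (intro mult_left_mono) auto
      moreover have "(F - fun_scale r V) z = - r * G z"
        by (simp add: F_def fun_scale_def algebra_simps)
      ultimately show "cmod ((F - fun_scale r V) z) \<le> \<epsilon>"
        using t \<epsilon> by (simp add: r_def norm_mult)
    qed
    finally show "dist_to F \<V> \<le> \<epsilon>" .
    show "F \<zeta>\<^sub>0 = of_real (t * ((1 + (\<Sum>k\<in>UNIV. cmod (a $ k))) * \<epsilon>))"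
      using G_eq[of \<zeta>\<^sub>0] V\<zeta>0
      by (simp add: F_def fun_scale_def r_def algebra_simps flip: s_def)
  qed
qed

text \<open>
  Since \<open>F\<close> and \<open>-F\<close> have the same samples, \<open>A\<close> returns one value for both, and the two targets
  \<open>F z\<close> and \<open>-F z\<close> are \<open>2 |F z|\<close> apart.
\<close>

lemma worst_case_error_ge_kernel_value:
  assumes F: "F \<in> K" "- F \<in> K" "sample \<zeta> F = 0"
  shows "ennreal (cmod (F z)) \<le> worst_case_error K (\<lambda>F. F z) \<zeta> A"
proof -
  have "sample \<zeta> (- F) = 0" using F(3) by (simp add: sample_def vec_eq_iff)
  then have *: "ennreal (cmod (F z - A 0)) \<le> worst_case_error K (\<lambda>F. F z) \<zeta> A"
    "ennreal (cmod (- F z - A 0)) \<le> worst_case_error K (\<lambda>F. F z) \<zeta> A"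
    using F SUP_upper[of F K "\<lambda>F. ennreal (cmod (F z - A (sample \<zeta> F)))"]
      SUP_upper[of "- F" K "\<lambda>F. ennreal (cmod (F z - A (sample \<zeta> F)))"]
    by (simp_all add: worst_case_error_def)
  have "2 * cmod (F z) = cmod ((F z - A 0) - (- F z - A 0))"
    by (simp add: norm_mult flip: mult_2)
  then have "2 * cmod (F z) \<le> cmod (F z - A 0) + cmod (- F z - A 0)"
    by (metis norm_triangle_ineq4)
  then have "cmod (F z) \<le> cmod (F z - A 0) \<or> cmod (F z) \<le> cmod (- F z - A 0)" by linarith
  then show ?thesis using * by (meson ennreal_leI order_trans)
qed

lemma dist_to_uminus:
  assumes "fun_vs.subspace \<V>"
  shows "dist_to (- F) \<V> = dist_to F \<V>"
proof -
  have "hinf_norm (- F - - V) = hinf_norm (F - V)" for V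
    by (simp add: hinf_norm_def norm_minus_commute)
  moreover have "uminus ` \<V> = \<V>"
    using fun_vs.subspace_neg[OF assms] by (force simp: image_iff)
  ultimately show ?thesis
    unfolding dist_to_def by (metis (no_types, lifting) image_image image_cong)
qed

lemma ennreal_le_of_mult_less_one:
  assumes "\<And>t. 0 < t \<Longrightarrow> t < 1 \<Longrightarrow> ennreal (t * c) \<le> X"
  shows "ennreal c \<le> X"
proof (cases X)
  case (real r)
  have "c \<le> r"
  proof (rule field_le_mult_one_interval)
    fix t :: real assume "0 < t" "t < 1"
    then have "ennreal (t * c) \<le> ennreal r" using assms real(2) by metis
    then show "t * c \<le> r" using real(1) ennreal_le_iff by metis
  qed
  then show ?thesis using real by (simp add: ennreal_leI)
qed simp

theorem theorem3:
  fixes \<V> :: "(complex \<Rightarrow> complex) set" and V :: "nat \<Rightarrow> complex \<Rightarrow> complex" and n :: nat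
    and \<zeta> :: "'m::finite \<Rightarrow> complex" and \<zeta>\<^sub>0 :: complex
    and Q :: "(complex \<Rightarrow> complex) \<Rightarrow> complex"
    and a :: "complex ^ 'm" and A_opt :: "complex ^ 'm \<Rightarrow> complex"
  assumes "fun_vs.subspace \<V>" and "\<V> \<subseteq> disc_algebra" and "fun_vs.dim \<V> = n"
    and "inj_on V {1..n}" and "fun_vs.independent (V ` {1..n})" and "fun_vs.span (V ` {1..n}) = \<V>"
    and "inj \<zeta>" and "range \<zeta> \<subseteq> sphere 0 1" and "n \<le> CARD('m)"
    and "\<zeta>\<^sub>0 \<in> sphere 0 1 - range \<zeta>"
    and "Q = (\<lambda>F. F \<zeta>\<^sub>0)"
    and "is_arg_min (\<lambda>b. \<Sum>k\<in>UNIV. cmod (b $ k))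
           (\<lambda>b. \<forall>j\<in>{1..n}. (\<Sum>k\<in>UNIV. b $ k * V j (\<zeta> k)) = V j \<zeta>\<^sub>0) a"
    and "A_opt = (\<lambda>y. \<Sum>k\<in>UNIV. a $ k * y $ k)"
  shows "compat_indicator (sample_kernel \<zeta>) \<V> Q = ennreal (1 + (\<Sum>k\<in>UNIV. cmod (a $ k)))
    \<and> Vector_Spaces.linear (*s) (*) A_opt
    \<and> (\<forall>\<epsilon>>0.
          worst_case_error (model_set \<epsilon> \<V>) Q \<zeta> A_opt
            = (INF A. worst_case_error (model_set \<epsilon> \<V>) Q \<zeta> A)
        \<and> worst_case_error (model_set \<epsilon> \<V>) Q \<zeta> A_opt
            = compat_indicator (sample_kernel \<zeta>) \<V> Q * ennreal \<epsilon>)"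
proof -
  define s where "s = (\<Sum>k\<in>UNIV. cmod (a $ k))"
  have s0: "s \<ge> 0" unfolding s_def by (intro sum_nonneg) auto
  have exact_iff: "(\<forall>j\<in>{1..n}. (\<Sum>k\<in>UNIV. b $ k * V j (\<zeta> k)) = V j \<zeta>\<^sub>0)
      \<longleftrightarrow> (\<forall>F\<in>\<V>. (\<Sum>k\<in>UNIV. b $ k * F (\<zeta> k)) = F \<zeta>\<^sub>0)" for b
  proof
    assume b: "\<forall>j\<in>{1..n}. (\<Sum>k\<in>UNIV. b $ k * V j (\<zeta> k)) = V j \<zeta>\<^sub>0"
    define E where "E = {F. (\<Sum>k\<in>UNIV. b $ k * F (\<zeta> k)) = F \<zeta>\<^sub>0}"
    have "fun_vs.subspace E"
      unfolding fun_vs.subspace_def E_def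
      by (auto simp: fun_scale_def algebra_simps sum.distrib simp flip: sum_distrib_left)
    then have "fun_vs.span (V ` {1..n}) \<subseteq> E"
      by (intro fun_vs.span_minimal) (use b in \<open>auto simp: E_def\<close>)
    then show "\<forall>F\<in>\<V>. (\<Sum>k\<in>UNIV. b $ k * F (\<zeta> k)) = F \<zeta>\<^sub>0"
      using assms(6) by (auto simp: E_def)
  next
    assume "\<forall>F\<in>\<V>. (\<Sum>k\<in>UNIV. b $ k * F (\<zeta> k)) = F \<zeta>\<^sub>0"
    moreover have "V j \<in> \<V>" if "j \<in> {1..n}" for j
      using that assms(6) fun_vs.span_base by blast
    ultimately show "\<forall>j\<in>{1..n}. (\<Sum>k\<in>UNIV. b $ k * V j (\<zeta> k)) = V j \<zeta>\<^sub>0" by blast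
  qed
  have exact: "(\<Sum>k\<in>UNIV. a $ k * F (\<zeta> k)) = F \<zeta>\<^sub>0" if "F \<in> \<V>" for F
    using assms(12) that unfolding is_arg_min_def exact_iff by blast
  have min: "(\<Sum>k\<in>UNIV. cmod (a $ k)) \<le> (\<Sum>k\<in>UNIV. cmod (b $ k))"
    if "\<And>F. F \<in> \<V> \<Longrightarrow> (\<Sum>k\<in>UNIV. b $ k * F (\<zeta> k)) = F \<zeta>\<^sub>0" for b
    using assms(12) that unfolding is_arg_min_def exact_iff by (auto simp: not_less)
  have ne: "\<V> \<noteq> {}" using fun_vs.subspace_0[OF assms(1)] by auto
  have upper: "cmod (F \<zeta>\<^sub>0 - (\<Sum>k\<in>UNIV. a $ k * F (\<zeta> k))) \<le> (1 + s) * dist_to F \<V>"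
    if "F \<in> disc_algebra" for F
    unfolding s_def using assms(2,8,10) ne exact that by (intro quadrature_error_bound) auto
  have upper_kernel: "cmod (F \<zeta>\<^sub>0) \<le> (1 + s) * dist_to F \<V>" if "F \<in> sample_kernel \<zeta>" for F
    using upper[of F] that by (simp add: sample_kernel_def sample_def vec_eq_iff)
  have lower: "\<exists>F\<in>sample_kernel \<zeta>. dist_to F \<V> \<le> \<epsilon> \<and> F \<zeta>\<^sub>0 = of_real (t * ((1 + s) * \<epsilon>))"
    if "0 < t" "t < 1" "\<epsilon> > 0" for t \<epsilon>
    using nearly_extremal_function[OF assms(1,2,7,8,10) exact min that] unfolding s_def by metis
  have indicator: "compat_indicator (sample_kernel \<zeta>) \<V> Q = ennreal (1 + s)"
  proof (rule antisym)
    show "compat_indicator (sample_kernel \<zeta>) \<V> Q \<le> ennreal (1 + s)"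
      unfolding compat_indicator_def
    proof (rule SUP_least)
      fix F assume "F \<in> {F \<in> sample_kernel \<zeta>. \<not> (Q F = 0 \<and> dist_to F \<V> = 0)}"
      then have F: "F \<in> sample_kernel \<zeta>" "F \<zeta>\<^sub>0 \<noteq> 0 \<or> dist_to F \<V> \<noteq> 0"
        using assms(11) by auto
      have "0 \<le> (1 + s) * dist_to F \<V>"
        using upper_kernel[OF F(1)] norm_ge_zero order_trans by blast
      (* At distance 0 the upper bound forces the value at \<zeta>\<^sub>0 to vanish, so only 0/0 is excluded. *)
      then have "dist_to F \<V> > 0"
        using F(2) upper_kernel[OF F(1)] s0 by (auto simp: zero_le_mult_iff less_le)
      then show "ennreal (cmod (Q F)) / ennreal (dist_to F \<V>) \<le> ennreal (1 + s)"
        using upper_kernel[OF F(1)] s0 assms(11)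
        by (simp add: divide_ennreal ennreal_leI divide_le_eq del: ennreal_plus)
    qed
    show "ennreal (1 + s) \<le> compat_indicator (sample_kernel \<zeta>) \<V> Q"
    proof (rule ennreal_le_of_mult_less_one)
      fix t :: real assume t: "0 < t" "t < 1"
      obtain F where F: "F \<in> sample_kernel \<zeta>" "dist_to F \<V> \<le> 1" "F \<zeta>\<^sub>0 = of_real (t * (1 + s))"
        using lower[OF t, of 1] by auto
      have norm: "cmod (F \<zeta>\<^sub>0) = t * (1 + s)" using F(3) t s0 by (simp only: norm_of_real) simp
      have "0 < t * (1 + s)" using t s0 by simp
      with upper_kernel[OF F(1)] norm have "0 < (1 + s) * dist_to F \<V>" by simp
      then have pos: "dist_to F \<V> > 0" using s0 by (simp add: zero_less_mult_iff)
      have "t * (1 + s) \<le> t * (1 + s) / dist_to F \<V>"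
        using pos F(2) \<open>0 < t * (1 + s)\<close> by (simp add: le_divide_eq mult_left_le)
      then have "ennreal (t * (1 + s)) \<le> ennreal (cmod (Q F)) / ennreal (dist_to F \<V>)"
        using norm pos \<open>0 < t * (1 + s)\<close> assms(11) by (simp add: divide_ennreal ennreal_leI)
      also have "\<dots> \<le> compat_indicator (sample_kernel \<zeta>) \<V> Q"
        unfolding compat_indicator_def using F(1) pos by (intro SUP_upper) auto
      finally show "ennreal (t * (1 + s)) \<le> compat_indicator (sample_kernel \<zeta>) \<V> Q" .
    qed
  qed
  have A_upper: "worst_case_error (model_set \<epsilon> \<V>) Q \<zeta> A_opt \<le> ennreal ((1 + s) * \<epsilon>)" for \<epsilon>
    unfolding worst_case_error_def
  proof (rule SUP_least)
    fix F assume F: "F \<in> model_set \<epsilon> \<V>"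
    then have "cmod (Q F - A_opt (sample \<zeta> F)) \<le> (1 + s) * dist_to F \<V>"
      using upper[of F] assms(11,13) by (simp add: model_set_def sample_def)
    also have "\<dots> \<le> (1 + s) * \<epsilon>"
      using F s0 by (intro mult_left_mono) (auto simp: model_set_def)
    finally show "ennreal (cmod (Q F - A_opt (sample \<zeta> F))) \<le> ennreal ((1 + s) * \<epsilon>)"
      by (rule ennreal_leI)
  qed
  have A_lower: "ennreal ((1 + s) * \<epsilon>) \<le> worst_case_error (model_set \<epsilon> \<V>) Q \<zeta> A"
    if \<epsilon>: "\<epsilon> > 0" for \<epsilon> A
  proof (rule ennreal_le_of_mult_less_one)
    fix t :: real assume t: "0 < t" "t < 1"
    obtain F where F: "F \<in> sample_kernel \<zeta>" "dist_to F \<V> \<le> \<epsilon>"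
      "F \<zeta>\<^sub>0 = of_real (t * ((1 + s) * \<epsilon>))"
      using lower[OF t \<epsilon>] by auto
    have "cmod (F \<zeta>\<^sub>0) = t * ((1 + s) * \<epsilon>)"
      using F(3) t s0 \<epsilon> by (simp only: norm_of_real) simp
    moreover have "F \<in> model_set \<epsilon> \<V>" "- F \<in> model_set \<epsilon> \<V>" "sample \<zeta> F = 0"
      using F(1,2) fun_vs.subspace_neg[OF subspace_disc_algebra]
      by (auto simp: model_set_def sample_kernel_def dist_to_uminus[OF assms(1)])
    ultimately show "ennreal (t * ((1 + s) * \<epsilon>)) \<le> worst_case_error (model_set \<epsilon> \<V>) Q \<zeta> A"
      using worst_case_error_ge_kernel_value[of F "model_set \<epsilon> \<V>" \<zeta> "\<zeta>\<^sub>0" A] assms(11) by simp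
  qed
  have optimal: "worst_case_error (model_set \<epsilon> \<V>) Q \<zeta> A_opt = ennreal ((1 + s) * \<epsilon>)"
    "(INF A. worst_case_error (model_set \<epsilon> \<V>) Q \<zeta> A) = ennreal ((1 + s) * \<epsilon>)"
    if "\<epsilon> > 0" for \<epsilon>
  proof -
    show eq: "worst_case_error (model_set \<epsilon> \<V>) Q \<zeta> A_opt = ennreal ((1 + s) * \<epsilon>)"
      using A_upper A_lower[OF that] by (rule antisym)
    show "(INF A. worst_case_error (model_set \<epsilon> \<V>) Q \<zeta> A) = ennreal ((1 + s) * \<epsilon>)"
      using A_lower[OF that] by (intro antisym INF_greatest INF_lower2[of A_opt]) (auto simp: eq)
  qed
  have "Vector_Spaces.linear (*s) (*) A_opt"
    unfolding assms(13)
    by unfold_locales (auto simp: algebra_simps sum.distrib sum_distrib_left)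
  moreover have "ennreal ((1 + s) * \<epsilon>) = ennreal (1 + s) * ennreal \<epsilon>" if "\<epsilon> > 0" for \<epsilon>
    using s0 that by (simp add: ennreal_mult)
  ultimately show ?thesis
    using indicator optimal by (simp add: s_def)
qed

end
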